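(* Consider the parametric weighted random graph mixture model with $Q\ge 2$ groups, and assume: (A1) the $Q(Q+1)/2$ values $\theta_{ql}$, $1\le q\le l\le Q$, are pairwise distinct; (A2) the family $\mathcal M=\{F(\cdot,\theta):\theta\in\Theta\}$ satisfies: (i) no $F(\cdot,\theta)$ has a point mass at $0$; (ii) finite mixtures from $\mathcal M$ are identifiable up to label swapping, i.e. for every integer $r\ge1$, if $\sum_{i=1}^r a_iF(\cdot,\theta_i)=\sum_{i=1}^r a_i'F(\cdot,\theta_i')$ (with nonnegative weights summing to 1) then $\sum_{i=1}^r a_i\delta_{\theta_i}=\sum_{i=1}^r a_i'\delta_{\theta_i'}$. Then the parameters $\boldsymbol\pi$, $\theta_{ql}$, $p_{ql}$, $1\le q\le l\le Q$, are identifiable, up to label swapping, from the joint distribution of $K_3$.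
   Context: Random graph mixture model: nodes have i.i.d. latent groups $Z_i\in\{1,\dots,Q\}$ with $\pi_q=\mathbb P(Z_i=q)\in(0,1)$, $\sum_q\pi_q=1$; edge variables $X_{ij}$ ($i<j$) are conditionally independent given all $Z$'s, with law of $X_{ij}$ depending only on $(Z_i,Z_j)$. Parametric weighted model: $X_{ij}$ takes values in $\mathcal X=\mathbb N$, $\mathbb R$ or $\mathbb R^s$, and given $Z_i=q,Z_j=l$ has law $\mu_{ql}=(1-p_{ql})\delta_0+p_{ql}F(\cdot,\theta_{ql})$, where $p_{ql}=p_{lq}\in(0,1]$, $\theta_{ql}=\theta_{lq}\in\Theta\subset\mathbb R^p$, $\delta_0$ is the Dirac mass at $0$, and $F(\cdot,\theta)$ is a probability measure with a density w.r.t. counting or Lebesgue measure. $K_n$ denotes the collection of the $\binom n2$ edge variables among $n$ nodes. "Up to label swapping" means up to a permutation $\sigma$ of $\{1,\dots,Q\}$ applied simultaneously to all group-indexed parameters. *)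

theory Defs
  imports "HOL-Probability.Probability" "HOL-Combinatorics.Permutations"
begin

text \<open>Groups are indexed by 0..Q-1. Edge values live in a Euclidean space 'x
  (covers N (as a subset of R), R and R^s), equipped with its Borel sigma-algebra.\<close>

definition edge_law :: "('t \<Rightarrow> 'x::euclidean_space measure) \<Rightarrow> real \<Rightarrow> 't \<Rightarrow> 'x measure" where
  "edge_law F p t = measure_of UNIV (sets borel)
     (\<lambda>A. ennreal (1 - p) * indicator A 0 + ennreal p * emeasure (F t) A)"

text \<open>Joint law of K_3 = (X_12, X_13, X_23) in the mixture model.\<close>
definition K3_law :: "nat \<Rightarrow> (nat \<Rightarrow> real) \<Rightarrow> (nat \<Rightarrow> nat \<Rightarrow> real) \<Rightarrow> (nat \<Rightarrow> nat \<Rightarrow> 't)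
     \<Rightarrow> ('t \<Rightarrow> 'x::euclidean_space measure) \<Rightarrow> ('x \<times> 'x \<times> 'x) measure" where
  "K3_law Q \<pi> p \<theta> F = measure_of UNIV (sets (borel \<Otimes>\<^sub>M (borel \<Otimes>\<^sub>M borel)))
     (\<lambda>S. \<Sum>q<Q. \<Sum>l<Q. \<Sum>m<Q. ennreal (\<pi> q * \<pi> l * \<pi> m) *
        emeasure (edge_law F (p q l) (\<theta> q l) \<Otimes>\<^sub>M
                  (edge_law F (p q m) (\<theta> q m) \<Otimes>\<^sub>M edge_law F (p l m) (\<theta> l m))) S)"

definition valid_params :: "nat \<Rightarrow> 't set \<Rightarrow> (nat \<Rightarrow> real) \<Rightarrow> (nat \<Rightarrow> nat \<Rightarrow> real)
     \<Rightarrow> (nat \<Rightarrow> nat \<Rightarrow> 't) \<Rightarrow> bool" where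
  "valid_params Q \<Theta> \<pi> p \<theta> \<longleftrightarrow>
     (\<forall>q<Q. 0 < \<pi> q \<and> \<pi> q < 1) \<and> (\<Sum>q<Q. \<pi> q) = 1 \<and>
     (\<forall>q<Q. \<forall>l<Q. 0 < p q l \<and> p q l \<le> 1 \<and> p q l = p l q \<and>
                  \<theta> q l \<in> \<Theta> \<and> \<theta> q l = \<theta> l q) \<and>
     (\<forall>q l q' l'. q \<le> l \<and> l < Q \<and> q' \<le> l' \<and> l' < Q \<and> \<theta> q l = \<theta> q' l'
        \<longrightarrow> q = q' \<and> l = l')"

text \<open>(A2)(ii): finite mixtures from the family are identifiable up to label swapping;
  the equality of discrete measures sum a_i delta_{theta_i} is written pointwise.\<close>
definition finite_mixture_identifiable :: "'t set \<Rightarrow> ('t \<Rightarrow> 'x::topological_space measure) \<Rightarrow> bool" where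
  "finite_mixture_identifiable \<Theta> F \<longleftrightarrow>
     (\<forall>(r::nat) (a::nat \<Rightarrow> real) t a' t'. r \<ge> 1 \<longrightarrow>
        (\<forall>i<r. a i \<ge> 0 \<and> a' i \<ge> 0 \<and> t i \<in> \<Theta> \<and> t' i \<in> \<Theta>) \<longrightarrow>
        (\<Sum>i<r. a i) = 1 \<longrightarrow> (\<Sum>i<r. a' i) = 1 \<longrightarrow>
        (\<forall>A \<in> sets borel. (\<Sum>i<r. a i * measure (F (t i)) A) = (\<Sum>i<r. a' i * measure (F (t' i)) A)) \<longrightarrow>
        (\<forall>s. (\<Sum>i\<in>{i. i < r \<and> t i = s}. a i) = (\<Sum>i\<in>{i. i < r \<and> t' i = s}. a' i)))"

end

theory Submission
  imports Defs
begin

(* The nonzero part of each edge variable is a mixture from the family F, with weights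
   pi_q pi_l p_ql and parameters theta_ql, because F(., theta) has no atom at 0 (A2)(i).
   The proof has three steps.
   1. Evaluating the law of K_3 on {X_12 <> 0} and on {X_12 <> 0, X_13 <> 0} gives finite
      mixtures of F and of products F x F; by (A2)(ii), applied once resp. twice, the weight
      of each parameter value (edge_weight) and of each pair of parameters on two edges with
      a common node (pair_weight) is determined by the law.
   2. The positivity of pair_weight gives an adjacency relation on parameter values.  By (A1)
      the diagonal values theta_aa are characterised in terms of adjacency, and the
      relation determines theta up to a permutation sigma of the groups.
   3. With theta' = theta o sigma, the weights at diagonal parameters are explicit monomials
      in pi and p, and they determine pi and p.
   The file first develops the measure theory of the edge and triangle laws, then the
   identifiability of finite mixtures for arbitrary weights, the combinatorics of
   adjacency, and finally combines them in theorem5. *)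


(* A set function that agrees on sets M with a nonnegative combination sum_i c_i N_i of
   measures on the same sigma-algebra is countably additive, so measure_of evaluates to it. *)
lemma emeasure_measure_of_combination:
  fixes M :: "'a measure" and N :: "'i \<Rightarrow> 'a measure" and c :: "'i \<Rightarrow> ennreal"
  assumes sets_N: "\<And>i. i \<in> I \<Longrightarrow> sets (N i) = sets M"
    and \<mu>: "\<And>S. S \<in> sets M \<Longrightarrow> \<mu> S = (\<Sum>i\<in>I. c i * emeasure (N i) S)"
    and X: "X \<in> sets M"
  shows "emeasure (measure_of (space M) (sets M) \<mu>) X = \<mu> X"
proof (rule emeasure_measure_of_sigma[OF sets.sigma_algebra_axioms _ _ X])
  show "positive (sets M) \<mu>"
    using \<mu> by (simp add: positive_def)
  show "countably_additive (sets M) \<mu>"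
  proof (rule countably_additiveI)
    fix B :: "nat \<Rightarrow> 'a set"
    assume B: "range B \<subseteq> sets M" "disjoint_family B" "(\<Union>n. B n) \<in> sets M"
    have "(\<Sum>n. \<mu> (B n)) = (\<Sum>n. \<Sum>i\<in>I. c i * emeasure (N i) (B n))"
      using B(1) \<mu> by auto
    also have "\<dots> = (\<Sum>i\<in>I. c i * (\<Sum>n. emeasure (N i) (B n)))"
      by (simp add: suminf_sum[OF summableI])
    also have "\<dots> = (\<Sum>i\<in>I. c i * emeasure (N i) (\<Union>n. B n))"
      using B(1,2) sets_N by (intro sum.cong refl) (simp add: suminf_emeasure)
    also have "\<dots> = \<mu> (\<Union>n. B n)"
      using \<mu> B(3) by simp
    finally show "(\<Sum>n. \<mu> (B n)) = \<mu> (\<Union>n. B n)" .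
  qed
qed

lemma emeasure_pair3_Times:
  assumes "prob_space M1" "prob_space M2" "prob_space M3"
    and "A \<in> sets M1" "B \<in> sets M2" "C \<in> sets M3"
  shows "emeasure (M1 \<Otimes>\<^sub>M (M2 \<Otimes>\<^sub>M M3)) (A \<times> B \<times> C) = emeasure M1 A * (emeasure M2 B * emeasure M3 C)"
proof -
  interpret M23: prob_space "M2 \<Otimes>\<^sub>M M3" using assms by (simp add: prob_space_pair)
  interpret M3: prob_space M3 using assms by simp
  show ?thesis
    using assms by (simp add: M23.emeasure_pair_measure_Times M3.emeasure_pair_measure_Times)
qed

lemma sets_edge_law: "sets (edge_law F p t) = sets borel"
  unfolding edge_law_def
  using sets.sigma_sets_eq[of borel] by (simp add: sets_measure_of_conv)

lemma emeasure_edge_law: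
  fixes F :: "'t \<Rightarrow> 'x::euclidean_space measure"
  assumes sets_F: "sets (F t) = sets borel" and A: "A \<in> sets borel"
  shows "emeasure (edge_law F p t) A = ennreal (1 - p) * indicator A 0 + ennreal p * emeasure (F t) A"
proof -
  let ?N = "\<lambda>b. if b then F t else return borel 0"
  let ?c = "\<lambda>b. if b then ennreal p else ennreal (1 - p)"
  have "emeasure (measure_of (space borel) (sets borel)
          (\<lambda>A. ennreal (1 - p) * indicator A 0 + ennreal p * emeasure (F t) A)) A
        = ennreal (1 - p) * indicator A (0::'x) + ennreal p * emeasure (F t) A"
    using sets_F A
    by (intro emeasure_measure_of_combination[where I = UNIV and N = ?N and c = ?c])
       (auto simp: UNIV_bool add.commute)
  then show ?thesis
    unfolding edge_law_def by simp
qed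

definition edge_value_family :: "'t set \<Rightarrow> ('t \<Rightarrow> 'x::euclidean_space measure) \<Rightarrow> bool" where
  "edge_value_family \<Theta> F \<longleftrightarrow>
     (\<forall>t\<in>\<Theta>. prob_space (F t) \<and> sets (F t) = sets borel \<and> emeasure (F t) {0} = 0)"

lemma edge_value_family_UNIV:
  assumes "edge_value_family \<Theta> F" "t \<in> \<Theta>"
  shows "measure (F t) UNIV = 1"
proof -
  have P: "prob_space (F t)" and sets_F: "sets (F t) = sets borel"
    using assms unfolding edge_value_family_def by auto
  have "space (F t) = UNIV"
    using sets_eq_imp_space_eq[OF sets_F] by simp
  then show ?thesis
    using prob_space.prob_space[OF P] by simp
qed

(* Because F(., t) puts no mass on 0, the nonzero part of an edge variable sees only
   p F(., t): this is how p and theta are separated from the Dirac mass. *)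
lemma measure_edge_law_nonzero:
  fixes F :: "'t \<Rightarrow> 'x::euclidean_space measure"
  assumes "edge_value_family \<Theta> F" "t \<in> \<Theta>" "0 \<le> p" and A: "A \<in> sets borel"
  shows "measure (edge_law F p t) (A - {0}) = p * measure (F t) A"
proof -
  interpret prob_space "F t" using assms unfolding edge_value_family_def by blast
  have sets_F: "sets (F t) = sets borel" and "{0} \<in> null_sets (F t)"
    using assms unfolding edge_value_family_def by (auto simp: null_sets_def)
  then have "emeasure (F t) (A - {0}) = ennreal (measure (F t) A)"
    using A by (simp add: emeasure_Diff_null_set flip: emeasure_eq_measure)
  then show ?thesis
    using emeasure_edge_law[where F = F and t = t and A = "A - {0}", OF sets_F] A \<open>0 \<le> p\<close>
    by (simp add: measure_def flip: ennreal_mult)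
qed

lemma prob_space_edge_law:
  fixes F :: "'t \<Rightarrow> 'x::euclidean_space measure"
  assumes "edge_value_family \<Theta> F" "t \<in> \<Theta>" "0 \<le> p" "p \<le> 1"
  shows "prob_space (edge_law F p t)"
proof
  interpret prob_space "F t" using assms unfolding edge_value_family_def by blast
  have sets_F: "sets (F t) = sets borel"
    using assms unfolding edge_value_family_def by blast
  have "space (F t) = UNIV" "space (edge_law F p t) = UNIV"
    using sets_eq_imp_space_eq[OF sets_F] sets_eq_imp_space_eq[OF sets_edge_law[of F p t]] by auto
  then show "emeasure (edge_law F p t) (space (edge_law F p t)) = 1"
    using emeasure_edge_law[where F = F and t = t and A = UNIV, OF sets_F] emeasure_space_1 assms(3,4)
    by (simp flip: ennreal_plus)
qed

lemma edge_law_finite: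
  fixes F :: "'t \<Rightarrow> 'x::euclidean_space measure"
  assumes "edge_value_family \<Theta> F" "t \<in> \<Theta>" "0 \<le> p" "p \<le> 1"
  shows "emeasure (edge_law F p t) S = ennreal (measure (edge_law F p t) S)"
    and "measure (edge_law F p t) UNIV = 1"
proof -
  interpret prob_space "edge_law F p t"
    using prob_space_edge_law[OF assms] .
  show "emeasure (edge_law F p t) S = ennreal (measure (edge_law F p t) S)"
    by (rule emeasure_eq_measure)
  show "measure (edge_law F p t) UNIV = 1"
    using prob_space sets_eq_imp_space_eq[OF sets_edge_law[of F p t]] by simp
qed

definition cube :: "nat \<Rightarrow> (nat \<times> nat \<times> nat) set" where
  "cube Q = {..<Q} \<times> {..<Q} \<times> {..<Q}"

definition group_prob :: "(nat \<Rightarrow> real) \<Rightarrow> nat \<times> nat \<times> nat \<Rightarrow> real" where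
  "group_prob \<pi> = (\<lambda>(q, l, m). \<pi> q * \<pi> l * \<pi> m)"

definition edge12 :: "(nat \<Rightarrow> nat \<Rightarrow> 'a) \<Rightarrow> nat \<times> nat \<times> nat \<Rightarrow> 'a" where
  "edge12 f = (\<lambda>(q, l, m). f q l)"

definition edge13 :: "(nat \<Rightarrow> nat \<Rightarrow> 'a) \<Rightarrow> nat \<times> nat \<times> nat \<Rightarrow> 'a" where
  "edge13 f = (\<lambda>(q, l, m). f q m)"

definition edge23 :: "(nat \<Rightarrow> nat \<Rightarrow> 'a) \<Rightarrow> nat \<times> nat \<times> nat \<Rightarrow> 'a" where
  "edge23 f = (\<lambda>(q, l, m). f l m)"

lemma valid_params_pos:
  assumes "valid_params Q \<Theta> \<pi> p \<theta>"
  shows "q < Q \<Longrightarrow> 0 < \<pi> q" and "q < Q \<Longrightarrow> l < Q \<Longrightarrow> 0 < p q l"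
  using assms unfolding valid_params_def by auto

lemma valid_params_triangle:
  assumes valid: "valid_params Q \<Theta> \<pi> p \<theta>" and i: "i \<in> cube Q"
  shows "0 \<le> group_prob \<pi> i"
    and "0 \<le> edge12 p i" "edge12 p i \<le> 1" "edge12 \<theta> i \<in> \<Theta>"
    and "0 \<le> edge13 p i" "edge13 p i \<le> 1" "edge13 \<theta> i \<in> \<Theta>"
    and "0 \<le> edge23 p i" "edge23 p i \<le> 1" "edge23 \<theta> i \<in> \<Theta>"
  using assms unfolding valid_params_def cube_def group_prob_def edge12_def edge13_def edge23_def
  by (auto simp: less_imp_le)

definition conditional_K3_law :: "(nat \<Rightarrow> nat \<Rightarrow> real) \<Rightarrow> (nat \<Rightarrow> nat \<Rightarrow> 't)
     \<Rightarrow> ('t \<Rightarrow> 'x::euclidean_space measure) \<Rightarrow> nat \<times> nat \<times> nat \<Rightarrow> ('x \<times> 'x \<times> 'x) measure" where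
  "conditional_K3_law p \<theta> F i =
     edge_law F (edge12 p i) (edge12 \<theta> i) \<Otimes>\<^sub>M
       (edge_law F (edge13 p i) (edge13 \<theta> i) \<Otimes>\<^sub>M edge_law F (edge23 p i) (edge23 \<theta> i))"

lemma emeasure_K3_law:
  fixes F :: "'t \<Rightarrow> 'x::euclidean_space measure"
  assumes X: "X \<in> sets (borel \<Otimes>\<^sub>M (borel \<Otimes>\<^sub>M borel))"
  shows "emeasure (K3_law Q \<pi> p \<theta> F) X =
    (\<Sum>i\<in>cube Q. ennreal (group_prob \<pi> i) * emeasure (conditional_K3_law p \<theta> F i) X)"
proof -
  let ?M = "borel \<Otimes>\<^sub>M (borel \<Otimes>\<^sub>M borel) :: ('x \<times> 'x \<times> 'x) measure"
  let ?\<mu> = "\<lambda>S. \<Sum>q<Q. \<Sum>l<Q. \<Sum>m<Q. ennreal (\<pi> q * \<pi> l * \<pi> m) *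
        emeasure (edge_law F (p q l) (\<theta> q l) \<Otimes>\<^sub>M
                  (edge_law F (p q m) (\<theta> q m) \<Otimes>\<^sub>M edge_law F (p l m) (\<theta> l m))) S"
  have nested: "?\<mu> S = (\<Sum>i\<in>cube Q. ennreal (group_prob \<pi> i) *
      emeasure (conditional_K3_law p \<theta> F i) S)" for S
    unfolding cube_def conditional_K3_law_def group_prob_def edge12_def edge13_def edge23_def
    by (simp add: sum.cartesian_product case_prod_beta)
  have "emeasure (measure_of (space ?M) (sets ?M) ?\<mu>) X = ?\<mu> X"
    using X nested
    by (intro emeasure_measure_of_combination[where I = "cube Q" and N = "conditional_K3_law p \<theta> F"
          and c = "\<lambda>i. ennreal (group_prob \<pi> i)"])
       (auto simp: conditional_K3_law_def sets_edge_law intro!: sets_pair_measure_cong)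
  then show ?thesis
    unfolding K3_law_def nested by (simp add: space_pair_measure)
qed

lemma K3_law_Times:
  fixes F :: "'t \<Rightarrow> 'x::euclidean_space measure"
  assumes family: "edge_value_family \<Theta> F" and valid: "valid_params Q \<Theta> \<pi> p \<theta>"
    and sets: "A \<in> sets borel" "B \<in> sets borel" "C \<in> sets borel"
  shows "emeasure (K3_law Q \<pi> p \<theta> F) (A \<times> B \<times> C) = ennreal (\<Sum>i\<in>cube Q. group_prob \<pi> i *
    measure (edge_law F (edge12 p i) (edge12 \<theta> i)) A * measure (edge_law F (edge13 p i) (edge13 \<theta> i)) B *
      measure (edge_law F (edge23 p i) (edge23 \<theta> i)) C)"
proof -
  have summand: "ennreal (group_prob \<pi> i) * emeasure (conditional_K3_law p \<theta> F i) (A \<times> B \<times> C)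
      = ennreal (group_prob \<pi> i *
    measure (edge_law F (edge12 p i) (edge12 \<theta> i)) A * measure (edge_law F (edge13 p i) (edge13 \<theta> i)) B *
      measure (edge_law F (edge23 p i) (edge23 \<theta> i)) C)"
    if i: "i \<in> cube Q" for i
    using valid_params_triangle[OF valid i] sets
    by (simp add: conditional_K3_law_def emeasure_pair3_Times prob_space_edge_law[OF family]
        sets_edge_law edge_law_finite[OF family] mult.assoc flip: ennreal_mult)
  have X: "A \<times> B \<times> C \<in> sets (borel \<Otimes>\<^sub>M (borel \<Otimes>\<^sub>M borel))"
    using sets by auto
  have "emeasure (K3_law Q \<pi> p \<theta> F) (A \<times> B \<times> C) = (\<Sum>i\<in>cube Q. ennreal (group_prob \<pi> i *
    measure (edge_law F (edge12 p i) (edge12 \<theta> i)) A * measure (edge_law F (edge13 p i) (edge13 \<theta> i)) B *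
      measure (edge_law F (edge23 p i) (edge23 \<theta> i)) C))"
    unfolding emeasure_K3_law[OF X] by (rule sum.cong[OF refl summand])
  also have "\<dots> = ennreal (\<Sum>i\<in>cube Q. group_prob \<pi> i *
    measure (edge_law F (edge12 p i) (edge12 \<theta> i)) A * measure (edge_law F (edge13 p i) (edge13 \<theta> i)) B *
      measure (edge_law F (edge23 p i) (edge23 \<theta> i)) C)"
    using valid_params_triangle[OF valid] by (intro sum_ennreal) simp
  finally show ?thesis .
qed

definition one_edge_weight :: "(nat \<Rightarrow> real) \<Rightarrow> (nat \<Rightarrow> nat \<Rightarrow> real) \<Rightarrow> nat \<times> nat \<times> nat \<Rightarrow> real" where
  "one_edge_weight \<pi> p i = group_prob \<pi> i * edge12 p i"

definition two_edge_weight :: "(nat \<Rightarrow> real) \<Rightarrow> (nat \<Rightarrow> nat \<Rightarrow> real) \<Rightarrow> nat \<times> nat \<times> nat \<Rightarrow> real" where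
  "two_edge_weight \<pi> p i = group_prob \<pi> i * edge12 p i * edge13 p i"

lemma K3_law_one_edge:
  fixes F :: "'t \<Rightarrow> 'x::euclidean_space measure"
  assumes family: "edge_value_family \<Theta> F" and valid: "valid_params Q \<Theta> \<pi> p \<theta>"
    and A: "A \<in> sets borel"
  shows "emeasure (K3_law Q \<pi> p \<theta> F) ((A - {0}) \<times> UNIV \<times> UNIV) =
    ennreal (\<Sum>i\<in>cube Q. one_edge_weight \<pi> p i * measure (F (edge12 \<theta> i)) A)"
  using K3_law_Times[OF family valid, of "A - {0}" UNIV UNIV] A valid_params_triangle[OF valid]
  by (simp add: measure_edge_law_nonzero[OF family] edge_law_finite[OF family] one_edge_weight_def
      mult.assoc cong: sum.cong)

(* The event {X_12 in A - {0}, X_13 in B - {0}} gives a mixture of products of two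
   members of the family: it records which parameters occur on two edges at a common node. *)
lemma K3_law_two_edges:
  fixes F :: "'t \<Rightarrow> 'x::euclidean_space measure"
  assumes family: "edge_value_family \<Theta> F" and valid: "valid_params Q \<Theta> \<pi> p \<theta>"
    and A: "A \<in> sets borel" and B: "B \<in> sets borel"
  shows "emeasure (K3_law Q \<pi> p \<theta> F) ((A - {0}) \<times> (B - {0}) \<times> UNIV) = ennreal (\<Sum>i\<in>cube Q.
    two_edge_weight \<pi> p i * measure (F (edge12 \<theta> i)) A * measure (F (edge13 \<theta> i)) B)"
  using K3_law_Times[OF family valid, of "A - {0}" "B - {0}" UNIV] A B valid_params_triangle[OF valid]
  by (simp add: measure_edge_law_nonzero[OF family] edge_law_finite[OF family] two_edge_weight_def
      mult_ac cong: sum.cong)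

(* The total weight that a finite mixture with weights c and parameters u puts on the
   parameter value s, i.e. the mass at s of the discrete measure sum_i c_i delta_{u_i}. *)
definition mixture_weight :: "'i set \<Rightarrow> ('i \<Rightarrow> real) \<Rightarrow> ('i \<Rightarrow> 't) \<Rightarrow> 't \<Rightarrow> real" where
  "mixture_weight I c u s = (\<Sum>i\<in>{i\<in>I. u i = s}. c i)"

lemma mixture_weight_as_sum:
  "finite I \<Longrightarrow> mixture_weight I c u s = (\<Sum>i\<in>I. if u i = s then c i else 0)"
  unfolding mixture_weight_def by (simp add: sum.inter_filter)

lemma mixture_weight_reindex:
  assumes h: "bij_betw h J I" and fin: "finite I"
  shows "mixture_weight J (c \<circ> h) (u \<circ> h) s = mixture_weight I c u s"
proof -
  have "finite J"
    using h fin bij_betw_finite by blast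
  then show ?thesis
    using sum.reindex_bij_betw[OF h, of "\<lambda>i. if u i = s then c i else 0"] fin
    by (simp add: mixture_weight_as_sum o_def)
qed

lemma mixture_weight_scale:
  "mixture_weight I (\<lambda>i. c i / T) u s = mixture_weight I c u s / T"
  unfolding mixture_weight_def by (simp add: sum_divide_distrib)

(* Assumption (A2)(ii), which is stated for index sets {..<r}, transferred to an arbitrary
   finite nonempty index set. *)
lemma mixture_weight_unique_normalized:
  fixes F :: "'t \<Rightarrow> 'x::euclidean_space measure"
  assumes ident: "finite_mixture_identifiable \<Theta> F"
    and fin: "finite I" and ne: "I \<noteq> {}"
    and weights: "\<And>i. i \<in> I \<Longrightarrow> 0 \<le> c i \<and> 0 \<le> c' i \<and> u i \<in> \<Theta> \<and> u' i \<in> \<Theta>"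
    and total: "(\<Sum>i\<in>I. c i) = 1" "(\<Sum>i\<in>I. c' i) = 1"
    and mix: "\<And>A. A \<in> sets borel \<Longrightarrow>
      (\<Sum>i\<in>I. c i * measure (F (u i)) A) = (\<Sum>i\<in>I. c' i * measure (F (u' i)) A)"
  shows "mixture_weight I c u s = mixture_weight I c' u' s"
proof -
  define r where "r = card I"
  obtain h where h: "bij_betw h {..<r} I"
    using ex_bij_betw_nat_finite[OF fin] unfolding r_def atLeast0LessThan by blast
  have r: "r \<ge> 1"
    using fin ne unfolding r_def by (simp add: Suc_le_eq card_gt_0_iff)
  have reindex: "(\<Sum>i<r. g (h i)) = (\<Sum>j\<in>I. g j)" for g :: "_ \<Rightarrow> real"
    using sum.reindex_bij_betw[OF h] .
  have "h i \<in> I" if "i < r" for i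
    using h that by (auto dest: bij_betwE)
  then have "\<forall>i<r. 0 \<le> c (h i) \<and> 0 \<le> c' (h i) \<and> u (h i) \<in> \<Theta> \<and> u' (h i) \<in> \<Theta>"
    using weights by blast
  moreover have "(\<Sum>i<r. c (h i)) = 1" "(\<Sum>i<r. c' (h i)) = 1"
    using total by (simp_all add: reindex)
  moreover have "\<forall>A\<in>sets borel. (\<Sum>i<r. c (h i) * measure (F (u (h i))) A) =
      (\<Sum>i<r. c' (h i) * measure (F (u' (h i))) A)"
  proof
    fix A :: "'x set"
    assume "A \<in> sets borel"
    then show "(\<Sum>i<r. c (h i) * measure (F (u (h i))) A) = (\<Sum>i<r. c' (h i) * measure (F (u' (h i))) A)"
      using mix reindex[of "\<lambda>j. c j * measure (F (u j)) A"] reindex[of "\<lambda>j. c' j * measure (F (u' j)) A"]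
      by simp
  qed
  ultimately have "(\<Sum>i\<in>{i. i < r \<and> u (h i) = s}. c (h i)) = (\<Sum>i\<in>{i. i < r \<and> u' (h i) = s}. c' (h i))"
    using ident[unfolded finite_mixture_identifiable_def, rule_format,
        where r = r and a = "\<lambda>i. c (h i)" and t = "\<lambda>i. u (h i)"
          and a' = "\<lambda>i. c' (h i)" and t' = "\<lambda>i. u' (h i)" and s = s] r
    by blast
  then have "mixture_weight {..<r} (c \<circ> h) (u \<circ> h) s = mixture_weight {..<r} (c' \<circ> h) (u' \<circ> h) s"
    unfolding mixture_weight_def by simp
  then show ?thesis
    unfolding mixture_weight_reindex[OF h fin] .
qed

(* (A2)(ii) for mixtures with arbitrary nonnegative weights: the total masses agree
   (evaluate at UNIV), so after normalisation the previous lemma applies. *)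
lemma mixture_weight_unique:
  fixes F :: "'t \<Rightarrow> 'x::euclidean_space measure"
  assumes ident: "finite_mixture_identifiable \<Theta> F" and family: "edge_value_family \<Theta> F"
    and fin: "finite I"
    and weights: "\<And>i. i \<in> I \<Longrightarrow> 0 \<le> c i \<and> 0 \<le> c' i \<and> u i \<in> \<Theta> \<and> u' i \<in> \<Theta>"
    and mix: "\<And>A. A \<in> sets borel \<Longrightarrow>
      (\<Sum>i\<in>I. c i * measure (F (u i)) A) = (\<Sum>i\<in>I. c' i * measure (F (u' i)) A)"
  shows "mixture_weight I c u s = mixture_weight I c' u' s"
proof -
  have nonneg: "0 \<le> c i" "0 \<le> c' i" and range: "u i \<in> \<Theta>" "u' i \<in> \<Theta>" if "i \<in> I" for i
    using weights[OF that] by auto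
  define T where "T = (\<Sum>i\<in>I. c i)"
  have "(\<Sum>i\<in>I. c i * measure (F (u i)) UNIV) = T" "(\<Sum>i\<in>I. c' i * measure (F (u' i)) UNIV) = (\<Sum>i\<in>I. c' i)"
    unfolding T_def by (simp_all add: edge_value_family_UNIV[OF family] range cong: sum.cong)
  then have T': "T = (\<Sum>i\<in>I. c' i)"
    using mix[of UNIV] by simp
  show ?thesis
  proof (cases "T = 0")
    case True
    then have "c i = 0" "c' i = 0" if "i \<in> I" for i
      using sum_nonneg_eq_0_iff[OF fin] nonneg T' that unfolding T_def by metis+
    then show ?thesis
      unfolding mixture_weight_def by simp
  next
    case False
    moreover have "0 \<le> T"
      unfolding T_def using nonneg by (simp add: sum_nonneg)
    ultimately have "T > 0" "I \<noteq> {}"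
      unfolding T_def by auto
    have scaled_mix: "(\<Sum>i\<in>I. c i / T * measure (F (u i)) A) = (\<Sum>i\<in>I. c' i / T * measure (F (u' i)) A)"
      if "A \<in> sets borel" for A
      using mix[OF that] by (simp add: sum_divide_distrib[symmetric])
    have "(\<Sum>i\<in>I. c i / T) = 1" "(\<Sum>i\<in>I. c' i / T) = 1"
      using \<open>T > 0\<close> T' by (simp_all add: T_def flip: sum_divide_distrib)
    then have "mixture_weight I (\<lambda>i. c i / T) u s = mixture_weight I (\<lambda>i. c' i / T) u' s"
      using weights \<open>T > 0\<close> \<open>I \<noteq> {}\<close> scaled_mix
      by (intro mixture_weight_unique_normalized[OF ident fin]) auto
    then show ?thesis
      unfolding mixture_weight_scale using \<open>T > 0\<close> by simp
  qed
qed

lemma mixture_weight_pair: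
  assumes "finite I"
  shows "mixture_weight I c (\<lambda>i. (u i, v i)) (s, s') = mixture_weight I (\<lambda>i. if u i = s then c i else 0) v s'"
proof -
  have "{i \<in> I. (u i, v i) = (s, s')} = {i \<in> {i \<in> I. v i = s'}. u i = s}"
    by auto
  moreover have "(\<Sum>i\<in>{i \<in> {i \<in> I. v i = s'}. u i = s}. c i) =
      (\<Sum>i\<in>{i \<in> I. v i = s'}. if u i = s then c i else 0)"
    using assms by (intro sum.inter_filter) simp
  ultimately show ?thesis
    unfolding mixture_weight_def by simp
qed

(* Identifiability of mixtures of products F(., u_i) x F(., v_i): fixing B and viewing the
   mixture as one in A identifies the weights of u_i = s, which are again a mixture in B. *)
lemma mixture_weight_unique_product:
  fixes F :: "'t \<Rightarrow> 'x::euclidean_space measure"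
  assumes ident: "finite_mixture_identifiable \<Theta> F" and family: "edge_value_family \<Theta> F"
    and fin: "finite I"
    and weights: "\<And>i. i \<in> I \<Longrightarrow> 0 \<le> c i \<and> 0 \<le> c' i \<and> u i \<in> \<Theta> \<and> u' i \<in> \<Theta> \<and> v i \<in> \<Theta> \<and> v' i \<in> \<Theta>"
    and mix: "\<And>A B. A \<in> sets borel \<Longrightarrow> B \<in> sets borel \<Longrightarrow>
      (\<Sum>i\<in>I. c i * measure (F (u i)) A * measure (F (v i)) B) =
      (\<Sum>i\<in>I. c' i * measure (F (u' i)) A * measure (F (v' i)) B)"
  shows "mixture_weight I c (\<lambda>i. (u i, v i)) (s, s') = mixture_weight I c' (\<lambda>i. (u' i, v' i)) (s, s')"
proof -
  have section_mix: "(\<Sum>i\<in>I. (if u i = s then c i else 0) * measure (F (v i)) B) =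
      (\<Sum>i\<in>I. (if u' i = s then c' i else 0) * measure (F (v' i)) B)" if B: "B \<in> sets borel" for B
  proof -
    have "mixture_weight I (\<lambda>i. c i * measure (F (v i)) B) u s = mixture_weight I (\<lambda>i. c' i * measure (F (v' i)) B) u' s"
      using weights mix[OF _ B]
      by (intro mixture_weight_unique[OF ident family fin]) (auto simp: mult_ac)
    then show ?thesis
      using fin by (simp add: mixture_weight_as_sum if_distrib[of "\<lambda>x. x * _"] cong: if_cong)
  qed
  have "mixture_weight I (\<lambda>i. if u i = s then c i else 0) v s' =
      mixture_weight I (\<lambda>i. if u' i = s then c' i else 0) v' s'"
    using weights section_mix by (intro mixture_weight_unique[OF ident family fin]) auto
  then show ?thesis
    using fin by (simp add: mixture_weight_pair)
qed

definition edge_weight :: "nat \<Rightarrow> (nat \<Rightarrow> real) \<Rightarrow> (nat \<Rightarrow> nat \<Rightarrow> real) \<Rightarrow> (nat \<Rightarrow> nat \<Rightarrow> 't) \<Rightarrow> 't \<Rightarrow> real" where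
  "edge_weight Q \<pi> p \<theta> = mixture_weight (cube Q) (one_edge_weight \<pi> p) (edge12 \<theta>)"

definition pair_weight :: "nat \<Rightarrow> (nat \<Rightarrow> real) \<Rightarrow> (nat \<Rightarrow> nat \<Rightarrow> real) \<Rightarrow> (nat \<Rightarrow> nat \<Rightarrow> 't) \<Rightarrow> 't \<Rightarrow> 't \<Rightarrow> real" where
  "pair_weight Q \<pi> p \<theta> s s' = mixture_weight (cube Q) (two_edge_weight \<pi> p) (\<lambda>i. (edge12 \<theta> i, edge13 \<theta> i)) (s, s')"

lemma valid_params_weights:
  assumes valid: "valid_params Q \<Theta> \<pi> p \<theta>" and i: "i \<in> cube Q"
  shows "0 \<le> one_edge_weight \<pi> p i" "0 \<le> two_edge_weight \<pi> p i"
  using valid_params_triangle[OF valid i] unfolding one_edge_weight_def two_edge_weight_def by simp_all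

lemma K3_law_identifies_weights:
  fixes F :: "'t \<Rightarrow> 'x::euclidean_space measure"
  assumes ident: "finite_mixture_identifiable \<Theta> F" and family: "edge_value_family \<Theta> F"
    and valid: "valid_params Q \<Theta> \<pi> p \<theta>" and valid': "valid_params Q \<Theta> \<pi>' p' \<theta>'"
    and same_law: "K3_law Q \<pi> p \<theta> F = K3_law Q \<pi>' p' \<theta>' F"
  shows "edge_weight Q \<pi> p \<theta> s = edge_weight Q \<pi>' p' \<theta>' s"
    and "pair_weight Q \<pi> p \<theta> s s' = pair_weight Q \<pi>' p' \<theta>' s s'"
proof -
  have fin: "finite (cube Q)"
    by (simp add: cube_def)
  have "(\<Sum>i\<in>cube Q. one_edge_weight \<pi> p i * measure (F (edge12 \<theta> i)) A) =
      (\<Sum>i\<in>cube Q. one_edge_weight \<pi>' p' i * measure (F (edge12 \<theta>' i)) A)" if A: "A \<in> sets borel" for A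
    using K3_law_one_edge[OF family valid A] K3_law_one_edge[OF family valid' A] same_law
      valid_params_weights[OF valid] valid_params_weights[OF valid']
    by (simp add: sum_nonneg)
  then show "edge_weight Q \<pi> p \<theta> s = edge_weight Q \<pi>' p' \<theta>' s"
    unfolding edge_weight_def
    using valid_params_weights[OF valid] valid_params_weights[OF valid']
      valid_params_triangle(4)[OF valid] valid_params_triangle(4)[OF valid']
    by (intro mixture_weight_unique[OF ident family fin]) auto
  have "(\<Sum>i\<in>cube Q. two_edge_weight \<pi> p i * measure (F (edge12 \<theta> i)) A * measure (F (edge13 \<theta> i)) B) =
      (\<Sum>i\<in>cube Q. two_edge_weight \<pi>' p' i * measure (F (edge12 \<theta>' i)) A * measure (F (edge13 \<theta>' i)) B)"
    if A: "A \<in> sets borel" and B: "B \<in> sets borel" for A B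
    using K3_law_two_edges[OF family valid A B] K3_law_two_edges[OF family valid' A B] same_law
      valid_params_weights[OF valid] valid_params_weights[OF valid']
    by (simp add: sum_nonneg)
  then show "pair_weight Q \<pi> p \<theta> s s' = pair_weight Q \<pi>' p' \<theta>' s s'"
    unfolding pair_weight_def
    using valid_params_weights[OF valid] valid_params_weights[OF valid']
      valid_params_triangle(4,7)[OF valid] valid_params_triangle(4,7)[OF valid']
    by (intro mixture_weight_unique_product[OF ident family fin]) auto
qed

lemma valid_params_theta_eq:
  assumes valid: "valid_params Q \<Theta> \<pi> p \<theta>" and "q < Q" "l < Q" "q' < Q" "l' < Q"
    and eq: "\<theta> q l = \<theta> q' l'"
  shows "(q = q' \<and> l = l') \<or> (q = l' \<and> l = q')"
proof -
  have sym: "\<theta> a b = \<theta> (min a b) (max a b)" if "a < Q" "b < Q" for a b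
    using valid that unfolding valid_params_def by (cases "a \<le> b") (auto simp: min_def max_def)
  have distinct: "\<And>q l q' l'. q \<le> l \<Longrightarrow> l < Q \<Longrightarrow> q' \<le> l' \<Longrightarrow> l' < Q \<Longrightarrow> \<theta> q l = \<theta> q' l' \<Longrightarrow> q = q' \<and> l = l'"
    using valid unfolding valid_params_def by blast
  have "min q l = min q' l' \<and> max q l = max q' l'"
  proof (rule distinct)
    show "\<theta> (min q l) (max q l) = \<theta> (min q' l') (max q' l')"
      using sym eq assms(2-5) by metis
  qed (use assms(2-5) in auto)
  then show ?thesis
    by (auto simp: min_def max_def split: if_splits)
qed

(* The diagonal values theta_{aa} are exactly the values whose neighbours are pairwise
   adjacent; this is how the graph of adjacencies recovers the group structure. *)
definition adjacent :: "nat \<Rightarrow> (nat \<Rightarrow> nat \<Rightarrow> 't) \<Rightarrow> 't \<Rightarrow> 't \<Rightarrow> bool" where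
  "adjacent Q \<theta> s s' \<longleftrightarrow> (\<exists>q<Q. \<exists>l<Q. \<exists>m<Q. \<theta> q l = s \<and> \<theta> q m = s')"

definition diagonal_value :: "nat \<Rightarrow> (nat \<Rightarrow> nat \<Rightarrow> 't) \<Rightarrow> 't \<Rightarrow> bool" where
  "diagonal_value Q \<theta> s \<longleftrightarrow> adjacent Q \<theta> s s \<and> (\<forall>x y. adjacent Q \<theta> s x \<and> adjacent Q \<theta> s y \<longrightarrow> adjacent Q \<theta> x y)"

lemma adjacentI: "q < Q \<Longrightarrow> l < Q \<Longrightarrow> m < Q \<Longrightarrow> adjacent Q \<theta> (\<theta> q l) (\<theta> q m)"
  unfolding adjacent_def by blast

lemma adjacent_diagonal:
  assumes valid: "valid_params Q \<Theta> \<pi> p \<theta>" and a: "a < Q" and adj: "adjacent Q \<theta> (\<theta> a a) x"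
  shows "\<exists>m<Q. x = \<theta> a m"
proof -
  obtain q l m where qlm: "q < Q" "l < Q" "m < Q" "\<theta> q l = \<theta> a a" "\<theta> q m = x"
    using adj unfolding adjacent_def by blast
  then have "q = a"
    using valid_params_theta_eq[OF valid, of q l a a] a by auto
  then show ?thesis
    using qlm by auto
qed

lemma diagonal_value_iff:
  assumes valid: "valid_params Q \<Theta> \<pi> p \<theta>"
  shows "diagonal_value Q \<theta> s \<longleftrightarrow> (\<exists>a<Q. s = \<theta> a a)"
proof
  assume diag: "diagonal_value Q \<theta> s"
  then obtain q l where ql: "q < Q" "l < Q" "\<theta> q l = s"
    unfolding diagonal_value_def adjacent_def by blast
  show "\<exists>a<Q. s = \<theta> a a"
  proof (cases "q = l")
    case True
    then show ?thesis using ql by auto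
  next
    case False
    have "\<theta> l q = s"
      using valid ql unfolding valid_params_def by metis
    then have "adjacent Q \<theta> s (\<theta> q q)" "adjacent Q \<theta> s (\<theta> l l)"
      using ql adjacentI[of q Q l q \<theta>] adjacentI[of l Q q l \<theta>] by simp_all
    then have "adjacent Q \<theta> (\<theta> q q) (\<theta> l l)"
      using diag unfolding diagonal_value_def by blast
    then obtain m where "m < Q" "\<theta> l l = \<theta> q m"
      using adjacent_diagonal[OF valid ql(1)] by blast
    then have "q = l"
      using valid_params_theta_eq[OF valid, of l l q m] ql by auto
    then show ?thesis
      using False by simp
  qed
next
  assume "\<exists>a<Q. s = \<theta> a a"
  then obtain a where a: "a < Q" "s = \<theta> a a"
    by blast
  show "diagonal_value Q \<theta> s"
    unfolding diagonal_value_def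
  proof (intro conjI allI impI)
    show "adjacent Q \<theta> s s"
      using a adjacentI by metis
    fix x y
    assume "adjacent Q \<theta> s x \<and> adjacent Q \<theta> s y"
    then obtain m m' where "m < Q" "x = \<theta> a m" "m' < Q" "y = \<theta> a m'"
      using adjacent_diagonal[OF valid a(1)] a(2) by blast
    then show "adjacent Q \<theta> x y"
      using a(1) adjacentI by metis
  qed
qed

lemma diagonal_relabelling:
  assumes valid': "valid_params Q \<Theta> \<pi>' p' \<theta>'"
    and diag: "\<And>q. q < Q \<Longrightarrow> \<exists>a<Q. \<theta> a a = \<theta>' q q"
  obtains \<sigma> where "\<sigma> permutes {..<Q}" "\<And>q. q < Q \<Longrightarrow> \<theta>' q q = \<theta> (\<sigma> q) (\<sigma> q)"
proof -
  define \<sigma> where "\<sigma> q = (if q < Q then (SOME a. a < Q \<and> \<theta> a a = \<theta>' q q) else q)" for q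
  have \<sigma>: "\<sigma> q < Q \<and> \<theta> (\<sigma> q) (\<sigma> q) = \<theta>' q q" if "q < Q" for q
    using someI_ex[OF diag[OF that]] that unfolding \<sigma>_def by simp
  have inj: "inj_on \<sigma> {..<Q}"
  proof (rule inj_onI)
    fix x y
    assume xy: "x \<in> {..<Q}" "y \<in> {..<Q}" "\<sigma> x = \<sigma> y"
    then have "\<theta>' x x = \<theta>' y y"
      using \<sigma>[of x] \<sigma>[of y] by simp
    then show "x = y"
      using valid_params_theta_eq[OF valid', of x x y y] xy by auto
  qed
  have "\<sigma> ` {..<Q} = {..<Q}"
    by (rule endo_inj_surj) (use inj \<sigma> in auto)
  then have "\<sigma> permutes {..<Q}"
    using inj by (intro bij_imp_permutes) (auto simp: bij_betw_def \<sigma>_def)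
  then show thesis
    using \<sigma> that by metis
qed

(* Two parametrisations with the same adjacency relation differ by a relabelling
   (Step 2): an off-diagonal theta'_{ql} is adjacent to both theta_{sigma q sigma q} and
   theta_{sigma l sigma l}, hence equals theta_{sigma q sigma l}. *)
lemma relabelling_from_adjacency:
  assumes valid: "valid_params Q \<Theta> \<pi> p \<theta>" and valid': "valid_params Q \<Theta> \<pi>' p' \<theta>'"
    and adj: "\<And>s s'. adjacent Q \<theta> s s' \<longleftrightarrow> adjacent Q \<theta>' s s'"
  obtains \<sigma> where "\<sigma> permutes {..<Q}" "\<And>q l. q < Q \<Longrightarrow> l < Q \<Longrightarrow> \<theta>' q l = \<theta> (\<sigma> q) (\<sigma> l)"
proof -
  have "diagonal_value Q \<theta> s \<longleftrightarrow> diagonal_value Q \<theta>' s" for s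
    unfolding diagonal_value_def adj ..
  then have "\<exists>a<Q. \<theta> a a = \<theta>' q q" if "q < Q" for q
    using that diagonal_value_iff[OF valid] diagonal_value_iff[OF valid'] by metis
  then obtain \<sigma> where perm: "\<sigma> permutes {..<Q}" and diag: "\<And>q. q < Q \<Longrightarrow> \<theta>' q q = \<theta> (\<sigma> q) (\<sigma> q)"
    using diagonal_relabelling[OF valid'] by metis
  have \<sigma>Q: "\<sigma> q < Q" if "q < Q" for q
    using permutes_in_image[OF perm] that by simp
  have off_diag: "\<theta>' q l = \<theta> (\<sigma> q) (\<sigma> l)" if ql: "q < Q" "l < Q" "q \<noteq> l" for q l
  proof -
    have "\<sigma> q \<noteq> \<sigma> l"
      using permutes_inj[OF perm] ql by (auto dest: injD)
    have sym: "\<theta>' l q = \<theta>' q l"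
      using valid' ql unfolding valid_params_def by metis
    have "adjacent Q \<theta>' (\<theta>' q q) (\<theta>' q l)" "adjacent Q \<theta>' (\<theta>' l l) (\<theta>' q l)"
      using ql adjacentI[of q Q q l \<theta>'] adjacentI[of l Q l q \<theta>'] sym by simp_all
    then have "adjacent Q \<theta> (\<theta> (\<sigma> q) (\<sigma> q)) (\<theta>' q l)" "adjacent Q \<theta> (\<theta> (\<sigma> l) (\<sigma> l)) (\<theta>' q l)"
      using adj diag ql by simp_all
    then obtain m1 m2 where m: "m1 < Q" "\<theta>' q l = \<theta> (\<sigma> q) m1" "m2 < Q" "\<theta>' q l = \<theta> (\<sigma> l) m2"
      using adjacent_diagonal[OF valid] \<sigma>Q ql by metis
    then have "m1 = \<sigma> l"
      using valid_params_theta_eq[OF valid, of "\<sigma> q" m1 "\<sigma> l" m2] \<open>\<sigma> q \<noteq> \<sigma> l\<close> \<sigma>Q ql by auto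
    then show ?thesis
      using m by simp
  qed
  show thesis
  proof (rule that[OF perm])
    fix q l
    assume "q < Q" "l < Q"
    then show "\<theta>' q l = \<theta> (\<sigma> q) (\<sigma> l)"
      using diag off_diag by (cases "q = l") simp_all
  qed
qed

lemma mixture_weight_pos_iff:
  assumes "finite I" "\<And>i. i \<in> I \<Longrightarrow> 0 < c i"
  shows "0 < mixture_weight I c u s \<longleftrightarrow> (\<exists>i\<in>I. u i = s)"
proof
  assume pos: "0 < mixture_weight I c u s"
  show "\<exists>i\<in>I. u i = s"
  proof (rule ccontr)
    assume "\<not> (\<exists>i\<in>I. u i = s)"
    then have "mixture_weight I c u s = 0"
      unfolding mixture_weight_def by (metis (mono_tags, lifting) empty_Collect_eq sum.empty)
    then show False
      using pos by simp
  qed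
next
  assume "\<exists>i\<in>I. u i = s"
  then obtain i where "i \<in> I" "u i = s"
    by blast
  then show "0 < mixture_weight I c u s"
    unfolding mixture_weight_def using assms
    by (intro sum_pos2[of _ i]) (auto intro: less_imp_le)
qed

(* All mixing weights are positive, so the pair weights determine adjacency. *)
lemma pair_weight_pos_iff:
  assumes valid: "valid_params Q \<Theta> \<pi> p \<theta>"
  shows "0 < pair_weight Q \<pi> p \<theta> s s' \<longleftrightarrow> adjacent Q \<theta> s s'"
proof -
  have "0 < two_edge_weight \<pi> p i" if "i \<in> cube Q" for i
    using that valid_params_pos[OF valid]
    by (auto simp: cube_def two_edge_weight_def group_prob_def edge12_def edge13_def)
  then show ?thesis
    unfolding pair_weight_def
    by (subst mixture_weight_pos_iff) (auto simp: cube_def adjacent_def edge12_def edge13_def)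
qed

lemma edge_weight_diagonal:
  assumes valid: "valid_params Q \<Theta> \<pi> p \<theta>" and a: "a < Q"
  shows "edge_weight Q \<pi> p \<theta> (\<theta> a a) = \<pi> a ^ 2 * p a a"
proof -
  have "{i \<in> cube Q. edge12 \<theta> i = \<theta> a a} = (\<lambda>m. (a, a, m)) ` {..<Q}"
    using valid_params_theta_eq[OF valid _ _ a a] a
    by (auto simp: cube_def edge12_def)
  then have "edge_weight Q \<pi> p \<theta> (\<theta> a a) = (\<Sum>m<Q. \<pi> a * \<pi> a * \<pi> m * p a a)"
    unfolding edge_weight_def mixture_weight_def
    by (simp add: sum.reindex inj_on_def one_edge_weight_def group_prob_def edge12_def)
  also have "\<dots> = \<pi> a ^ 2 * p a a * (\<Sum>m<Q. \<pi> m)"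
    by (simp add: sum_distrib_left power2_eq_square mult_ac)
  also have "\<dots> = \<pi> a ^ 2 * p a a"
    using valid unfolding valid_params_def by simp
  finally show ?thesis .
qed

lemma pair_weight_diagonal:
  assumes valid: "valid_params Q \<Theta> \<pi> p \<theta>" and a: "a < Q" and b: "b < Q"
  shows "pair_weight Q \<pi> p \<theta> (\<theta> a a) (\<theta> a b) = \<pi> a ^ 2 * \<pi> b * p a a * p a b"
proof -
  have "{i \<in> cube Q. (edge12 \<theta> i, edge13 \<theta> i) = (\<theta> a a, \<theta> a b)} = {(a, a, b)}"
  proof (intro set_eqI iffI)
    fix i
    assume "i \<in> {i \<in> cube Q. (edge12 \<theta> i, edge13 \<theta> i) = (\<theta> a a, \<theta> a b)}"
    then obtain q l m where i: "i = (q, l, m)" "q < Q" "l < Q" "m < Q" "\<theta> q l = \<theta> a a" "\<theta> q m = \<theta> a b"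
      by (auto simp: cube_def edge12_def edge13_def)
    then have "q = a" "l = a"
      using valid_params_theta_eq[OF valid, of q l a a] a by auto
    then have "m = b"
      using valid_params_theta_eq[OF valid, of a m a b] i a b by auto
    then show "i \<in> {(a, a, b)}"
      using i \<open>q = a\<close> \<open>l = a\<close> by simp
  qed (use a b in \<open>auto simp: cube_def edge12_def edge13_def\<close>)
  then show ?thesis
    unfolding pair_weight_def mixture_weight_def
    by (simp add: two_edge_weight_def group_prob_def edge12_def edge13_def power2_eq_square)
qed

lemma positive_solution_unique:
  fixes x y x' y' :: real
  assumes pos: "0 < x" "0 < y" "0 < x'" "0 < y'"
    and eq2: "x' ^ 2 * y' = x ^ 2 * y" and eq3: "x' ^ 3 * y' ^ 2 = x ^ 3 * y ^ 2"
  shows "x' = x \<and> y' = y"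
proof -
  have "x' = (x' ^ 2 * y') ^ 2 / (x' ^ 3 * y' ^ 2)"
    using pos by (simp add: field_simps power2_eq_square power3_eq_cube)
  also have "\<dots> = (x ^ 2 * y) ^ 2 / (x ^ 3 * y ^ 2)"
    by (simp only: eq2 eq3)
  also have "\<dots> = x"
    using pos by (simp add: field_simps power2_eq_square power3_eq_cube)
  finally have "x' = x" .
  then show ?thesis
    using eq2 pos by simp
qed

(* Step 3: once theta' = theta o sigma, the weights at (theta_aa) and (theta_aa, theta_ab)
   give pi_a^2 p_aa and pi_a^2 pi_b p_aa p_ab, from which pi and p follow. *)
lemma params_from_weights:
  assumes valid: "valid_params Q \<Theta> \<pi> p \<theta>" and valid': "valid_params Q \<Theta> \<pi>' p' \<theta>'"
    and perm: "\<sigma> permutes {..<Q}" and relabel: "\<And>q l. q < Q \<Longrightarrow> l < Q \<Longrightarrow> \<theta>' q l = \<theta> (\<sigma> q) (\<sigma> l)"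
    and W1: "\<And>s. edge_weight Q \<pi> p \<theta> s = edge_weight Q \<pi>' p' \<theta>' s"
    and W2: "\<And>s s'. pair_weight Q \<pi> p \<theta> s s' = pair_weight Q \<pi>' p' \<theta>' s s'"
  shows "\<forall>q<Q. \<pi>' q = \<pi> (\<sigma> q)" and "\<forall>q<Q. \<forall>l<Q. p' q l = p (\<sigma> q) (\<sigma> l)"
proof -
  have \<sigma>Q: "\<sigma> q < Q" if "q < Q" for q
    using permutes_in_image[OF perm] that by simp
  have pair: "\<pi>' a ^ 2 * \<pi>' b * p' a a * p' a b = \<pi> (\<sigma> a) ^ 2 * \<pi> (\<sigma> b) * p (\<sigma> a) (\<sigma> a) * p (\<sigma> a) (\<sigma> b)"
    if "a < Q" "b < Q" for a b
    using W2[of "\<theta>' a a" "\<theta>' a b"] pair_weight_diagonal[OF valid' that] relabel[of a a] relabel[of a b]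
      pair_weight_diagonal[OF valid \<sigma>Q \<sigma>Q] that by simp
  have diag: "\<pi>' a = \<pi> (\<sigma> a) \<and> p' a a = p (\<sigma> a) (\<sigma> a)" if a: "a < Q" for a
  proof (rule positive_solution_unique)
    show "\<pi>' a ^ 2 * p' a a = \<pi> (\<sigma> a) ^ 2 * p (\<sigma> a) (\<sigma> a)"
      using W1[of "\<theta>' a a"] edge_weight_diagonal[OF valid' a] relabel[OF a a]
        edge_weight_diagonal[OF valid \<sigma>Q[OF a]] by simp
    show "\<pi>' a ^ 3 * p' a a ^ 2 = \<pi> (\<sigma> a) ^ 3 * p (\<sigma> a) (\<sigma> a) ^ 2"
      using pair[OF a a] by (simp add: power2_eq_square power3_eq_cube mult_ac)
  qed (use a \<sigma>Q valid_params_pos[OF valid] valid_params_pos[OF valid'] in auto)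
  then show "\<forall>q<Q. \<pi>' q = \<pi> (\<sigma> q)"
    by blast
  show "\<forall>q<Q. \<forall>l<Q. p' q l = p (\<sigma> q) (\<sigma> l)"
  proof (intro allI impI)
    fix a b
    assume ab: "a < Q" "b < Q"
    have "\<pi> (\<sigma> a) ^ 2 * \<pi> (\<sigma> b) * p (\<sigma> a) (\<sigma> a) \<noteq> 0"
      using ab \<sigma>Q valid_params_pos[OF valid] by (simp add: less_imp_neq[symmetric])
    then show "p' a b = p (\<sigma> a) (\<sigma> b)"
      using pair[OF ab] diag[OF ab(1)] diag[OF ab(2)] by simp
  qed
qed

theorem theorem5:
  fixes Q :: nat and \<Theta> :: "'t::euclidean_space set"
    and F :: "'t \<Rightarrow> 'x::euclidean_space measure"
    and \<pi> \<pi>' :: "nat \<Rightarrow> real" and p p' :: "nat \<Rightarrow> nat \<Rightarrow> real"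
    and \<theta> \<theta>' :: "nat \<Rightarrow> nat \<Rightarrow> 't"
  assumes Q2: "Q \<ge> 2"
    and F_prob: "\<And>t. t \<in> \<Theta> \<Longrightarrow> prob_space (F t) \<and> sets (F t) = sets borel"
    and A2i: "\<And>t. t \<in> \<Theta> \<Longrightarrow> emeasure (F t) {0} = 0"
    and A2ii: "finite_mixture_identifiable \<Theta> F"
    and valid: "valid_params Q \<Theta> \<pi> p \<theta>"
    and valid': "valid_params Q \<Theta> \<pi>' p' \<theta>'"
    and same_law: "K3_law Q \<pi> p \<theta> F = K3_law Q \<pi>' p' \<theta>' F"
  shows "\<exists>\<sigma>. \<sigma> permutes {..<Q} \<and> (\<forall>q<Q. \<pi>' q = \<pi> (\<sigma> q)) \<and>
           (\<forall>q<Q. \<forall>l<Q. p' q l = p (\<sigma> q) (\<sigma> l) \<and> \<theta>' q l = \<theta> (\<sigma> q) (\<sigma> l))"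
proof -
  have family: "edge_value_family \<Theta> F"
    using F_prob A2i unfolding edge_value_family_def by blast
  note weights = K3_law_identifies_weights[OF A2ii family valid valid' same_law]
  have "adjacent Q \<theta> s s' \<longleftrightarrow> adjacent Q \<theta>' s s'" for s s'
    using pair_weight_pos_iff[OF valid] pair_weight_pos_iff[OF valid'] weights(2) by metis
  then obtain \<sigma> where perm: "\<sigma> permutes {..<Q}"
    and relabel: "\<And>q l. q < Q \<Longrightarrow> l < Q \<Longrightarrow> \<theta>' q l = \<theta> (\<sigma> q) (\<sigma> l)"
    using relabelling_from_adjacency[OF valid valid'] by metis
  show ?thesis
    using perm relabel params_from_weights[OF valid valid' perm relabel weights] by blast
qed

end
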